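(* Let $V_1(x)=4\,\mathrm{sech}^2(x)$, $V_2(x)=2\,\mathrm{sech}^2(x)$, and $(\Psi_1(x),\Psi_2(x))=(\tanh^2(x),-\mathrm{sech}^2(x))$ for $x\in\mathbb{R}$. Then, for both choices of sign, $$\int_{\mathbb{R}}e^{\pm\sqrt2\,y}\big(V_2(y)\Psi_1(y)+V_1(y)\Psi_2(y)\big)\,dy=0 .$$
   Context: No further context is needed; $\mathrm{sech}=1/\cosh$. *)

theory Defs
  imports "HOL-Analysis.Analysis"
begin

definition sech :: "real \<Rightarrow> real"
  where "sech x = 1 / cosh x"

definition V1 :: "real \<Rightarrow> real"
  where "V1 x = 4 * (sech x)\<^sup>2"

definition V2 :: "real \<Rightarrow> real"
  where "V2 x = 2 * (sech x)\<^sup>2"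

definition Psi1 :: "real \<Rightarrow> real"
  where "Psi1 x = (tanh x)\<^sup>2"

definition Psi2 :: "real \<Rightarrow> real"
  where "Psi2 x = - (sech x)\<^sup>2"

end

theory Submission
  imports Defs
begin

text \<open>For \<open>a\<^sup>2 = 2\<close>, since \<open>(sech\<^sup>2)'' = 4 sech\<^sup>2 - 6 sech\<^sup>4\<close>, the integrand
  \<open>exp (a y) (2 sech\<^sup>2 y - 6 sech\<^sup>4 y)\<close> is the derivative of
  \<open>exp (a y) ((sech\<^sup>2)' y - a sech\<^sup>2 y)\<close>, which vanishes at both infinities because \<open>\<bar>a\<bar> < 2\<close>.
  Integrability follows by comparison with \<open>sech\<^sup>2 (y / 4)\<close>, the derivative of \<open>4 tanh (y / 4)\<close>.\<close>

lemma tanh_square_sech: "(tanh x)\<^sup>2 = 1 - (sech x)\<^sup>2"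
  by (simp add: sech_def tanh_def power_divide sinh_square_eq diff_divide_distrib)

lemma has_real_derivative_sech [derivative_intros]:
  "(f has_real_derivative f') (at x within S) \<Longrightarrow>
   ((\<lambda>x. sech (f x)) has_real_derivative - sech (f x) * tanh (f x) * f') (at x within S)"
  unfolding sech_def
  by (auto intro!: derivative_eq_intros simp: tanh_def power2_eq_square)

lemma continuous_on_sech [continuous_intros]:
  "continuous_on S f \<Longrightarrow> continuous_on S (\<lambda>x. sech (f x))"
  unfolding sech_def by (intro continuous_intros) auto

lemma abs_sech_le_1: "\<bar>sech x\<bar> \<le> 1"
  using cosh_real_ge_1[of x] by (simp add: sech_def)

text \<open>The integrand is nonnegative and its antiderivative \<open>tanh (c * y) / c\<close> has
  finite limits at both infinities, so the fundamental theorem for nonnegative functions yields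
  integrability as a conclusion.\<close>

lemma integrable_sech_square_scaled:
  fixes c :: real
  assumes "c > 0"
  shows "integrable lborel (\<lambda>y. (sech (c * y))\<^sup>2)"
proof -
  have "filterlim (\<lambda>y. c * y) at_top at_top" "filterlim (\<lambda>y. c * y) at_bot at_bot"
    using assms
    by (auto intro: filterlim_tendsto_pos_mult_at_top filterlim_tendsto_pos_mult_at_bot
        filterlim_ident)
  note tanh_lim = filterlim_compose[OF tanh_real_at_top this(1)]
    filterlim_compose[OF tanh_real_at_bot this(2)]
  have lim: "((\<lambda>y. tanh (c * y) / c) \<longlongrightarrow> 1 / c) at_top"
    "((\<lambda>y. tanh (c * y) / c) \<longlongrightarrow> (-1) / c) at_bot"
    using assms by (intro tendsto_divide tendsto_const tanh_lim; simp)+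
  have "set_integrable lborel (einterval (-\<infinity>) \<infinity>) (\<lambda>y. (sech (c * y))\<^sup>2)"
  proof (rule interval_integral_FTC_nonneg(1)[where F = "\<lambda>y. tanh (c * y) / c"])
    fix x :: real
    show "((\<lambda>y. tanh (c * y) / c) has_real_derivative (sech (c * x))\<^sup>2) (at x)"
      using assms by (auto intro!: derivative_eq_intros simp: tanh_square_sech)
    have "continuous_on UNIV (\<lambda>y. (sech (c * y))\<^sup>2)"
      by (intro continuous_intros)
    then show "isCont (\<lambda>y. (sech (c * y))\<^sup>2) x"
      by (simp add: continuous_on_eq_continuous_at)
  next
    show "(((\<lambda>y. tanh (c * y) / c) \<circ> real_of_ereal) \<longlongrightarrow> (-1) / c) (at_right (-\<infinity>))"
      "(((\<lambda>y. tanh (c * y) / c) \<circ> real_of_ereal) \<longlongrightarrow> 1 / c) (at_left \<infinity>)"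
      using lim by (simp_all add: ereal_tendsto_simps)
  qed auto
  then show ?thesis
    by (simp add: set_integrable_def einterval_def)
qed

text \<open>The number \<open>3 / 2\<close> is a rational bound between \<open>sqrt 2\<close> and 2.
  The scale \<open>1 / 4\<close> uses up the rest: \<open>3 / 2 + 2 * (1 / 4) = 2\<close>, the
  growth exponent of \<open>(cosh y)\<^sup>2\<close>.\<close>

lemma exp_mult_sech_square_le:
  assumes "\<bar>a\<bar> \<le> 3 / 2"
  shows "exp (a * y) * (sech y)\<^sup>2 \<le> 4 * (sech (1 / 4 * y))\<^sup>2"
proof -
  have "exp \<bar>x\<bar> \<le> 2 * cosh x" "cosh x \<le> exp \<bar>x\<bar>" for x :: real
    by (cases "x \<ge> 0"; simp add: cosh_def)+
  then have lo: "exp \<bar>y\<bar> \<le> 2 * cosh y" and up: "cosh (y / 4) \<le> exp \<bar>y / 4\<bar>"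
    by blast+
  have "exp (a * y) * (cosh (y / 4))\<^sup>2 \<le> exp (3 / 2 * \<bar>y\<bar>) * (exp \<bar>y / 4\<bar>)\<^sup>2"
  proof (intro mult_mono power_mono up)
    have "a * y \<le> \<bar>a\<bar> * \<bar>y\<bar>"
      by (metis abs_ge_self abs_mult)
    also have "\<dots> \<le> 3 / 2 * \<bar>y\<bar>"
      using assms by (intro mult_right_mono) auto
    finally show "exp (a * y) \<le> exp (3 / 2 * \<bar>y\<bar>)" by simp
  qed auto
  also have "\<dots> = (exp \<bar>y\<bar>)\<^sup>2"
    by (simp add: power2_eq_square flip: exp_add)
  also have "\<dots> \<le> (2 * cosh y)\<^sup>2"
    by (intro power_mono lo) auto
  finally show ?thesis
    by (simp add: sech_def field_simps)
qed

text \<open>Supplies the boundary terms: the antiderivative used below is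
  \<open>exp (a * y) * (sech y)\<^sup>2\<close> times a bounded factor, and the majorant decays
  since \<open>cosh (1 / 4 * y)\<close> is unbounded in both directions.\<close>

lemma tendsto_exp_mult_sech_square_mult_bounded:
  assumes a: "\<bar>a\<bar> \<le> 3 / 2" and g: "\<And>y. \<bar>g y\<bar> \<le> B"
    and F: "F = at_top \<or> F = at_bot"
  shows "((\<lambda>y. exp (a * y) * (sech y)\<^sup>2 * g y) \<longlongrightarrow> 0) F"
proof (rule Lim_null_comparison)
  have "\<bar>exp (a * y) * (sech y)\<^sup>2 * g y\<bar> \<le> 4 * (sech (1 / 4 * y))\<^sup>2 * B" for y
    unfolding abs_mult
    by (rule mult_mono) (use exp_mult_sech_square_le[OF a] g in auto)
  then show "\<forall>\<^sub>F y in F. norm (exp (a * y) * (sech y)\<^sup>2 * g y) \<le> 4 * (sech (1 / 4 * y))\<^sup>2 * B"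
    by simp
  have "filterlim (\<lambda>y. cosh (1 / 4 * y :: real)) at_top F"
    using F
  proof
    assume "F = at_top"
    then show ?thesis
      by (auto intro!: filterlim_compose[OF cosh_real_at_top] filterlim_ident
          filterlim_tendsto_pos_mult_at_top[OF tendsto_const] simp del: times_divide_eq_left)
  next
    assume "F = at_bot"
    then show ?thesis
      by (auto intro!: filterlim_compose[OF cosh_real_at_bot] filterlim_ident
          filterlim_tendsto_pos_mult_at_bot[OF tendsto_const] simp del: times_divide_eq_left)
  qed
  then have "((\<lambda>y. sech (1 / 4 * y)) \<longlongrightarrow> 0) F"
    unfolding sech_def
    by (intro real_tendsto_divide_at_top[OF tendsto_const])
  then show "((\<lambda>y. 4 * (sech (1 / 4 * y))\<^sup>2 * B) \<longlongrightarrow> 0) F"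
    by (auto intro!: tendsto_eq_intros)
qed

text \<open>The sign of \<open>a\<close> does not matter, so \<open>a = sqrt 2\<close> and
  \<open>a = - sqrt 2\<close> are treated together. The predicate includes integrability, so the
  value 0 is not the default integral of a non-integrable function.\<close>

lemma has_bochner_integral_exp_mult_zero:
  fixes a :: real
  assumes a2: "a\<^sup>2 = 2"
  shows "has_bochner_integral lborel (\<lambda>y. exp (a * y) * (V2 y * Psi1 y + V1 y * Psi2 y)) 0"
proof -
  have a: "\<bar>a\<bar> \<le> 3 / 2"
    by (rule power2_le_imp_le) (auto simp: a2 power_divide)
  define f where "f y = exp (a * y) * (sech y)\<^sup>2 * (2 - 6 * (sech y)\<^sup>2)" for y
  \<comment> \<open>With s the square of \<open>sech\<close>, s' is
    \<open>- 2 * (sech y)\<^sup>2 * tanh y\<close>, so \<open>H\<close> is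
    \<open>exp (a * y)\<close> times s' - a s.\<close>
  define H where "H y = exp (a * y) * (sech y)\<^sup>2 * (- 2 * tanh y - a)" for y
  have f_eq: "exp (a * y) * (V2 y * Psi1 y + V1 y * Psi2 y) = f y" for y
    by (simp add: f_def V1_def V2_def Psi1_def Psi2_def tanh_square_sech algebra_simps)
  have cont: "continuous_on UNIV f"
    unfolding f_def by (intro continuous_intros)
  have int: "integrable lborel f"
  proof (rule Bochner_Integration.integrable_bound)
    show "integrable lborel (\<lambda>y. 4 * (sech (1 / 4 * y))\<^sup>2 * 8)"
      by (intro integrable_mult_left integrable_mult_right integrable_sech_square_scaled) auto
    show "f \<in> borel_measurable lborel"
      using borel_measurable_continuous_onI[OF cont] by simp
    have "(sech y)\<^sup>2 \<le> 1" for y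
      using abs_sech_le_1[of y] by (simp add: abs_square_le_1)
    then have g: "\<bar>2 - 6 * (sech y)\<^sup>2\<bar> \<le> 8" for y
      by (smt (verit) zero_le_power2)
    have "\<bar>f y\<bar> \<le> 4 * (sech (1 / 4 * y))\<^sup>2 * 8" for y
      unfolding f_def abs_mult
      by (rule mult_mono) (use exp_mult_sech_square_le[OF a] g in auto)
    then show "AE y in lborel. norm (f y) \<le> norm (4 * (sech (1 / 4 * y))\<^sup>2 * 8)"
      by simp
  qed
  \<comment> \<open>The factor is at most 2 + 3/2 in absolute value; any constant bound would
    do.\<close>
  have bnd: "\<bar>- 2 * tanh y - a\<bar> \<le> 4" for y
    using a tanh_real_bounds[of y] by (auto simp: abs_le_iff)
  have lim: "(H \<longlongrightarrow> 0) at_top" "(H \<longlongrightarrow> 0) at_bot"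
    unfolding H_def using tendsto_exp_mult_sech_square_mult_bounded[OF a bnd] by auto
  have "(LBINT y=-\<infinity>..\<infinity>. f y) = 0 - 0"
  proof (rule interval_integral_FTC_integrable[where F = H])
    fix x :: real
    \<comment> \<open>In the product rule the terms a s' cancel, leaving s'' - a^2 s; the bracket is
      this difference divided by s.\<close>
    have "(H has_real_derivative
        exp (a * x) * (sech x)\<^sup>2 * (4 * (tanh x)\<^sup>2 - 2 * (1 - (tanh x)\<^sup>2) - a\<^sup>2)) (at x)"
      unfolding H_def
      by (auto intro!: derivative_eq_intros simp: algebra_simps power2_eq_square)
    moreover have "4 * (tanh x)\<^sup>2 - 2 * (1 - (tanh x)\<^sup>2) - a\<^sup>2 = 2 - 6 * (sech x)\<^sup>2"
      by (simp add: tanh_square_sech a2)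
    ultimately show "(H has_vector_derivative f x) (at x)"
      unfolding f_def has_real_derivative_iff_has_vector_derivative by metis
    show "isCont f x"
      using cont by (simp add: continuous_on_eq_continuous_at)
  next
    show "set_integrable lborel (einterval (-\<infinity>) \<infinity>) f"
      using int by (simp add: set_integrable_def einterval_def)
    show "((H \<circ> real_of_ereal) \<longlongrightarrow> 0) (at_right (-\<infinity>))"
      "((H \<circ> real_of_ereal) \<longlongrightarrow> 0) (at_left \<infinity>)"
      using lim by (simp_all add: ereal_tendsto_simps)
  qed auto
  then have "integral\<^sup>L lborel f = 0"
    by (simp add: interval_lebesgue_integral_def set_lebesgue_integral_def einterval_def)
  with int show ?thesis
    unfolding f_eq by (simp add: has_bochner_integral_iff)
qed

theorem lemma1p5:
  shows "has_bochner_integral lborel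
           (\<lambda>y::real. exp (sqrt 2 * y) * (V2 y * Psi1 y + V1 y * Psi2 y)) 0
       \<and> has_bochner_integral lborel
           (\<lambda>y::real. exp (- sqrt 2 * y) * (V2 y * Psi1 y + V1 y * Psi2 y)) 0"
  by (intro conjI has_bochner_integral_exp_mult_zero) auto

end
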